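(* Let $(D_\lambda)_{\lambda\in\Lambda}$ be a family of Prüfer domains and set $R=\prod_{\lambda\in\Lambda}D_\lambda$. Assume that $\mathcal{F}$ is a countably incomplete ultrafilter on $\Lambda$ and $\mathcal{U}$ is an ultrafilter on $\dot\bigcup_{\lambda\in\Lambda}\max(D_\lambda)$ such that $\mathcal{F}$ is the ultrafilter on $\Lambda$ induced by $\mathcal{U}$. If $\mathcal{U}$ has the additional property that there exist $Y\in\mathcal{U}$ and $N\in\mathbb{N}$ with $|Y\cap\max(D_\lambda)|\leq N$ for all $\lambda\in\Lambda$, then for every prime ideal $P\subseteq R$ with $(0)_{\mathcal{F}}\subsetneq P\subseteq(\mathcal{U})$ there exists some prime ideal $Q\subseteq R$ such that $(0)_{\mathcal{F}}\subsetneq Q\subsetneq P$. In particular, every prime ideal $P$ of $R$ with $(0)_{\mathcal{F}}\subsetneq P\subseteq(\mathcal{U})$ is of infinite height.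
   Context: $\max(D)$ is the set of maximal ideals of $D$ and $X=\dot\bigcup_{\lambda\in\Lambda}\max(D_\lambda)$ is the disjoint union; for $M\in X$, $\lambda$ denotes the index with $M\in\max(D_\lambda)$. An ultrafilter $\mathcal{F}$ on a set $\Lambda$ is countably incomplete if there exists a countable partition $(P_n)_{n\in\mathbb{N}}$ of $\Lambda$ such that $P_n\notin\mathcal{F}$ for every $n\in\mathbb{N}$. The ultrafilter on $\Lambda$ induced by $\mathcal{U}$ is $\mathcal{F}_{\mathcal{U}}=\{F_U\mid U\in\mathcal{U}\}$, where $F_U=\{\lambda\in\Lambda\mid U\cap\max(D_\lambda)\neq\emptyset\}$. $(0)_{\mathcal{F}}=\{x\in R\mid\{\lambda\in\Lambda\mid x_\lambda=0\}\in\mathcal{F}\}$ and $(\mathcal{U})=\{r\in R\mid\{M\in X\mid r_\lambda\in M\}\in\mathcal{U}\}$; both are prime ideals of $R$. *)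

theory Defs
  imports "HOL-Algebra.Algebra" "HOL-Library.Extended_Nat" "HOL-Library.Disjoint_Sets"
begin

section \<open>Quotient field of a domain\<close>

definition frac_rel :: "('a, 'm) ring_scheme \<Rightarrow> (('a \<times> 'a) \<times> ('a \<times> 'a)) set" where
  "frac_rel D = {((a, b), (c, d)).
     a \<in> carrier D \<and> c \<in> carrier D \<and> b \<in> carrier D - {\<zero>\<^bsub>D\<^esub>} \<and> d \<in> carrier D - {\<zero>\<^bsub>D\<^esub>} \<and>
     a \<otimes>\<^bsub>D\<^esub> d = c \<otimes>\<^bsub>D\<^esub> b}"

definition frac_class :: "('a, 'm) ring_scheme \<Rightarrow> 'a \<Rightarrow> 'a \<Rightarrow> ('a \<times> 'a) set" where
  "frac_class D a b = frac_rel D `` {(a, b)}"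

text \<open>The unions below run over all representatives of the two classes; they are unions of copies
  of a single class, see \<open>frac_mult\<close> and \<open>frac_add\<close>.\<close>

definition frac_field :: "('a, 'm) ring_scheme \<Rightarrow> (('a \<times> 'a) set) ring" where
  "frac_field D =
    \<lparr> carrier = (carrier D \<times> (carrier D - {\<zero>\<^bsub>D\<^esub>})) // frac_rel D,
      monoid.mult = (\<lambda>A B. \<Union>{frac_class D (a \<otimes>\<^bsub>D\<^esub> c) (b \<otimes>\<^bsub>D\<^esub> d)
               | a b c d. (a, b) \<in> A \<and> (c, d) \<in> B}),
      monoid.one = frac_class D \<one>\<^bsub>D\<^esub> \<one>\<^bsub>D\<^esub>,
      ring.zero = frac_class D \<zero>\<^bsub>D\<^esub> \<one>\<^bsub>D\<^esub>,
      ring.add = (\<lambda>A B. \<Union>{frac_class D (a \<otimes>\<^bsub>D\<^esub> d \<oplus>\<^bsub>D\<^esub> c \<otimes>\<^bsub>D\<^esub> b) (b \<otimes>\<^bsub>D\<^esub> d)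
               | a b c d. (a, b) \<in> A \<and> (c, d) \<in> B}) \<rparr>"

definition frac_embed :: "('a, 'm) ring_scheme \<Rightarrow> 'a \<Rightarrow> ('a \<times> 'a) set" where
  "frac_embed D a = frac_class D a \<one>\<^bsub>D\<^esub>"

lemma (in domain) equiv_frac_rel:
  "equiv (carrier R \<times> (carrier R - {\<zero>})) (frac_rel R)"
proof (rule equivI)
  show "frac_rel R \<subseteq> (carrier R \<times> (carrier R - {\<zero>})) \<times> (carrier R \<times> (carrier R - {\<zero>}))"
    by (auto simp: frac_rel_def)
  show "refl_on (carrier R \<times> (carrier R - {\<zero>})) (frac_rel R)"
    by (auto simp: refl_on_def frac_rel_def)
  show "sym (frac_rel R)"
    by (auto simp: sym_def frac_rel_def)
  show "trans (frac_rel R)"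
  proof (rule transI, clarify)
    fix a b c d e f
    assume "((a, b), (c, d)) \<in> frac_rel R" "((c, d), (e, f)) \<in> frac_rel R"
    then have cl: "a \<in> carrier R" "b \<in> carrier R" "c \<in> carrier R" "d \<in> carrier R"
        "e \<in> carrier R" "f \<in> carrier R" "b \<noteq> \<zero>" "d \<noteq> \<zero>" "f \<noteq> \<zero>"
      and 1: "a \<otimes> d = c \<otimes> b" and 2: "c \<otimes> f = e \<otimes> d"
      by (auto simp: frac_rel_def)
    have "d \<otimes> (a \<otimes> f) = (a \<otimes> d) \<otimes> f" using cl by (simp add: m_ac)
    also have "\<dots> = (c \<otimes> f) \<otimes> b" using cl 1 by (simp add: m_ac)
    also have "\<dots> = d \<otimes> (e \<otimes> b)" using cl 2 by (simp add: m_ac)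
    finally have "a \<otimes> f = e \<otimes> b" using cl m_lcancel[of d "a \<otimes> f" "e \<otimes> b"] by simp
    with cl show "((a, b), (e, f)) \<in> frac_rel R" by (simp add: frac_rel_def)
  qed
qed

lemma (in domain) frac_eq_iff:
  assumes "a \<in> carrier R" "b \<in> carrier R" "b \<noteq> \<zero>" "c \<in> carrier R" "d \<in> carrier R" "d \<noteq> \<zero>"
  shows "frac_class R a b = frac_class R c d \<longleftrightarrow> a \<otimes> d = c \<otimes> b"
  using eq_equiv_class_iff[OF equiv_frac_rel, of "(a, b)" "(c, d)"] assms
  by (auto simp: frac_class_def frac_rel_def)

lemma (in domain) frac_closed:
  assumes "a \<in> carrier R" "b \<in> carrier R" "b \<noteq> \<zero>"
  shows "frac_class R a b \<in> carrier (frac_field R)"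
  using assms by (auto simp: frac_field_def frac_class_def intro: quotientI)

lemma (in domain) frac_fieldE:
  assumes "x \<in> carrier (frac_field R)"
  obtains a b where "a \<in> carrier R" "b \<in> carrier R" "b \<noteq> \<zero>" "x = frac_class R a b"
  using assms by (auto simp: frac_field_def frac_class_def elim!: quotientE)

lemma (in domain) frac_mem:
  assumes "a \<in> carrier R" "b \<in> carrier R" "b \<noteq> \<zero>"
  shows "(c, d) \<in> frac_class R a b \<longleftrightarrow>
    c \<in> carrier R \<and> d \<in> carrier R \<and> d \<noteq> \<zero> \<and> frac_class R c d = frac_class R a b"
proof -
  have "(c, d) \<in> frac_class R a b \<longleftrightarrow> c \<in> carrier R \<and> d \<in> carrier R \<and> d \<noteq> \<zero> \<and> a \<otimes> d = c \<otimes> b"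
    using assms by (auto simp: frac_class_def frac_rel_def)
  moreover have "frac_class R c d = frac_class R a b \<longleftrightarrow> c \<otimes> b = a \<otimes> d"
    if "c \<in> carrier R" "d \<in> carrier R" "d \<noteq> \<zero>"
    using frac_eq_iff[OF that assms] .
  ultimately show ?thesis by metis
qed

lemma (in domain) frac_mult:
  assumes "a \<in> carrier R" "b \<in> carrier R" "b \<noteq> \<zero>" "c \<in> carrier R" "d \<in> carrier R" "d \<noteq> \<zero>"
  shows "frac_class R a b \<otimes>\<^bsub>frac_field R\<^esub> frac_class R c d = frac_class R (a \<otimes> c) (b \<otimes> d)"
proof -
  have "frac_class R (a' \<otimes> c') (b' \<otimes> d') = frac_class R (a \<otimes> c) (b \<otimes> d)"
    if "(a', b') \<in> frac_class R a b" "(c', d') \<in> frac_class R c d" for a' b' c' d'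
  proof -
    have cl: "a' \<in> carrier R" "b' \<in> carrier R" "b' \<noteq> \<zero>" "c' \<in> carrier R" "d' \<in> carrier R"
        "d' \<noteq> \<zero>" and e: "a' \<otimes> b = a \<otimes> b'" "c' \<otimes> d = c \<otimes> d'"
      using that assms by (auto simp: frac_mem frac_eq_iff)
    have "(a' \<otimes> c') \<otimes> (b \<otimes> d) = (a' \<otimes> b) \<otimes> (c' \<otimes> d)" using cl assms by (simp add: m_ac)
    also have "\<dots> = (a \<otimes> c) \<otimes> (b' \<otimes> d')" unfolding e using cl assms by (simp add: m_ac)
    finally show ?thesis using cl assms by (subst frac_eq_iff) (auto simp: integral_iff)
  qed
  moreover have "(a, b) \<in> frac_class R a b" "(c, d) \<in> frac_class R c d"
    using assms by (auto simp: frac_mem)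
  ultimately have "{frac_class R (a' \<otimes> c') (b' \<otimes> d')
      | a' b' c' d'. (a', b') \<in> frac_class R a b \<and> (c', d') \<in> frac_class R c d} = {frac_class R (a \<otimes> c) (b \<otimes> d)}"
    (is "?S = {?q}") by blast
  then have "\<Union>?S = ?q" by (simp only: cSup_singleton)
  then show ?thesis by (simp add: frac_field_def)
qed

lemma (in domain) frac_add:
  assumes "a \<in> carrier R" "b \<in> carrier R" "b \<noteq> \<zero>" "c \<in> carrier R" "d \<in> carrier R" "d \<noteq> \<zero>"
  shows "frac_class R a b \<oplus>\<^bsub>frac_field R\<^esub> frac_class R c d = frac_class R (a \<otimes> d \<oplus> c \<otimes> b) (b \<otimes> d)"
proof -
  have "frac_class R (a' \<otimes> d' \<oplus> c' \<otimes> b') (b' \<otimes> d') = frac_class R (a \<otimes> d \<oplus> c \<otimes> b) (b \<otimes> d)"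
    if "(a', b') \<in> frac_class R a b" "(c', d') \<in> frac_class R c d" for a' b' c' d'
  proof -
    have cl: "a' \<in> carrier R" "b' \<in> carrier R" "b' \<noteq> \<zero>" "c' \<in> carrier R" "d' \<in> carrier R"
        "d' \<noteq> \<zero>" and e: "a' \<otimes> b = a \<otimes> b'" "c' \<otimes> d = c \<otimes> d'"
      using that assms by (auto simp: frac_mem frac_eq_iff)
    have "(a' \<otimes> d' \<oplus> c' \<otimes> b') \<otimes> (b \<otimes> d) = (a' \<otimes> b) \<otimes> (d' \<otimes> d) \<oplus> (c' \<otimes> d) \<otimes> (b' \<otimes> b)"
      using cl assms by algebra
    also have "\<dots> = (a \<otimes> d \<oplus> c \<otimes> b) \<otimes> (b' \<otimes> d')"
      unfolding e using cl assms by algebra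
    finally show ?thesis using cl assms by (subst frac_eq_iff) (auto simp: integral_iff)
  qed
  moreover have "(a, b) \<in> frac_class R a b" "(c, d) \<in> frac_class R c d"
    using assms by (auto simp: frac_mem)
  ultimately have "{frac_class R (a' \<otimes> d' \<oplus> c' \<otimes> b') (b' \<otimes> d')
      | a' b' c' d'. (a', b') \<in> frac_class R a b \<and> (c', d') \<in> frac_class R c d} = {frac_class R (a \<otimes> d \<oplus> c \<otimes> b) (b \<otimes> d)}"
    (is "?S = {?q}") by blast
  then have "\<Union>?S = ?q" by (simp only: cSup_singleton)
  then show ?thesis by (simp add: frac_field_def)
qed

lemma (in domain) frac_zero: "\<zero>\<^bsub>frac_field R\<^esub> = frac_class R \<zero> \<one>"
  and frac_one: "\<one>\<^bsub>frac_field R\<^esub> = frac_class R \<one> \<one>"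
  by (simp_all add: frac_field_def)

lemma (in domain) field_frac_field: "field (frac_field R)"
proof -
  let ?K = "frac_field R"
  note s = frac_mult frac_add frac_zero frac_one frac_eq_iff integral_iff
  have "cring ?K"
  proof (rule cringI)
    show "abelian_group ?K"
    proof (rule abelian_groupI)
      fix x assume "x \<in> carrier ?K"
      then obtain a b where x: "a \<in> carrier R" "b \<in> carrier R" "b \<noteq> \<zero>" "x = frac_class R a b"
        by (rule frac_fieldE)
      then have "frac_class R (\<ominus> a) b \<oplus>\<^bsub>?K\<^esub> x = \<zero>\<^bsub>?K\<^esub>"
        by (simp add: s l_minus l_neg)
      moreover have "frac_class R (\<ominus> a) b \<in> carrier ?K" using x by (simp add: frac_closed)
      ultimately show "\<exists>y\<in>carrier ?K. y \<oplus>\<^bsub>?K\<^esub> x = \<zero>\<^bsub>?K\<^esub>" by (rule bexI)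
    next
      fix x y z
      assume "x \<in> carrier ?K" "y \<in> carrier ?K" "z \<in> carrier ?K"
      then obtain a b c d e f
        where x: "a \<in> carrier R" "b \<in> carrier R" "b \<noteq> \<zero>" "x = frac_class R a b"
          and y: "c \<in> carrier R" "d \<in> carrier R" "d \<noteq> \<zero>" "y = frac_class R c d"
          and z: "e \<in> carrier R" "f \<in> carrier R" "f \<noteq> \<zero>" "z = frac_class R e f"
        by (meson frac_fieldE)
      have "((a \<otimes> d \<oplus> c \<otimes> b) \<otimes> f \<oplus> e \<otimes> (b \<otimes> d)) \<otimes> (b \<otimes> (d \<otimes> f))
          = (a \<otimes> (d \<otimes> f) \<oplus> (c \<otimes> f \<oplus> e \<otimes> d) \<otimes> b) \<otimes> (b \<otimes> d \<otimes> f)"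
        using x y z by algebra
      then show "x \<oplus>\<^bsub>?K\<^esub> y \<oplus>\<^bsub>?K\<^esub> z = x \<oplus>\<^bsub>?K\<^esub> (y \<oplus>\<^bsub>?K\<^esub> z)"
        unfolding x(4) y(4) z(4) using x(1-3) y(1-3) z(1-3) by (simp add: frac_add frac_mult frac_eq_iff integral_iff)
      have "(a \<otimes> d \<oplus> c \<otimes> b) \<otimes> (d \<otimes> b) = (c \<otimes> b \<oplus> a \<otimes> d) \<otimes> (b \<otimes> d)"
        using x y by algebra
      then show "x \<oplus>\<^bsub>?K\<^esub> y = y \<oplus>\<^bsub>?K\<^esub> x"
        unfolding x(4) y(4) using x(1-3) y(1-3) by (simp add: frac_add frac_eq_iff integral_iff)
      show "\<zero>\<^bsub>?K\<^esub> \<oplus>\<^bsub>?K\<^esub> x = x" "x \<oplus>\<^bsub>?K\<^esub> y \<in> carrier ?K"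
        using x y by (simp_all add: s frac_closed)
    next
      show "\<zero>\<^bsub>?K\<^esub> \<in> carrier ?K"
        unfolding frac_zero by (rule frac_closed) simp_all
    qed
    show "comm_monoid ?K"
    proof (rule comm_monoidI)
      fix x y z
      assume "x \<in> carrier ?K" "y \<in> carrier ?K" "z \<in> carrier ?K"
      then obtain a b c d e f
        where x: "a \<in> carrier R" "b \<in> carrier R" "b \<noteq> \<zero>" "x = frac_class R a b"
          and y: "c \<in> carrier R" "d \<in> carrier R" "d \<noteq> \<zero>" "y = frac_class R c d"
          and z: "e \<in> carrier R" "f \<in> carrier R" "f \<noteq> \<zero>" "z = frac_class R e f"
        by (meson frac_fieldE)
      show "x \<otimes>\<^bsub>?K\<^esub> y \<otimes>\<^bsub>?K\<^esub> z = x \<otimes>\<^bsub>?K\<^esub> (y \<otimes>\<^bsub>?K\<^esub> z)" "x \<otimes>\<^bsub>?K\<^esub> y = y \<otimes>\<^bsub>?K\<^esub> x"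
        "\<one>\<^bsub>?K\<^esub> \<otimes>\<^bsub>?K\<^esub> x = x" "x \<otimes>\<^bsub>?K\<^esub> y \<in> carrier ?K"
        using x y z by (simp_all add: frac_mult frac_one frac_closed m_ac integral_iff)
    next
      show "\<one>\<^bsub>?K\<^esub> \<in> carrier ?K"
        unfolding frac_one by (rule frac_closed) simp_all
    qed
    fix x y z
    assume "x \<in> carrier ?K" "y \<in> carrier ?K" "z \<in> carrier ?K"
    then obtain a b c d e f
      where x: "a \<in> carrier R" "b \<in> carrier R" "b \<noteq> \<zero>" "x = frac_class R a b"
        and y: "c \<in> carrier R" "d \<in> carrier R" "d \<noteq> \<zero>" "y = frac_class R c d"
        and z: "e \<in> carrier R" "f \<in> carrier R" "f \<noteq> \<zero>" "z = frac_class R e f"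
      by (meson frac_fieldE)
    have "(a \<otimes> d \<oplus> c \<otimes> b) \<otimes> e \<otimes> (b \<otimes> f \<otimes> (d \<otimes> f))
        = (a \<otimes> e \<otimes> (d \<otimes> f) \<oplus> c \<otimes> e \<otimes> (b \<otimes> f)) \<otimes> (b \<otimes> d \<otimes> f)"
      using x y z by algebra
    then show "(x \<oplus>\<^bsub>?K\<^esub> y) \<otimes>\<^bsub>?K\<^esub> z = x \<otimes>\<^bsub>?K\<^esub> z \<oplus>\<^bsub>?K\<^esub> y \<otimes>\<^bsub>?K\<^esub> z"
      unfolding x(4) y(4) z(4) using x(1-3) y(1-3) z(1-3) by (simp add: frac_add frac_mult frac_eq_iff integral_iff)
  qed
  then show ?thesis
  proof (rule cring.cring_fieldI2)
    show "\<zero>\<^bsub>?K\<^esub> \<noteq> \<one>\<^bsub>?K\<^esub>" by (simp add: s)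
    fix x assume "x \<in> carrier ?K" and nz: "x \<noteq> \<zero>\<^bsub>?K\<^esub>"
    from this(1) obtain a b
      where x: "a \<in> carrier R" "b \<in> carrier R" "b \<noteq> \<zero>" "x = frac_class R a b"
      by (rule frac_fieldE)
    have a: "a \<noteq> \<zero>" using nz x(1-3) unfolding x(4) by (auto simp: frac_zero frac_eq_iff)
    have "x \<otimes>\<^bsub>?K\<^esub> frac_class R b a = \<one>\<^bsub>?K\<^esub>"
      unfolding x(4) using x(1-3) a by (simp add: s m_ac)
    moreover have "frac_class R b a \<in> carrier ?K" using x a by (simp add: frac_closed)
    ultimately show "\<exists>y\<in>carrier ?K. x \<otimes>\<^bsub>?K\<^esub> y = \<one>\<^bsub>?K\<^esub>" by (rule bexI)
  qed
qed

lemma (in domain) frac_embed_hom: "frac_embed R \<in> ring_hom R (frac_field R)"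
  and frac_embed_inj: "inj_on (frac_embed R) (carrier R)"
proof -
  show "frac_embed R \<in> ring_hom R (frac_field R)"
    by (rule ring_hom_memI)
      (simp_all add: frac_embed_def frac_mult frac_add frac_one frac_closed)
  show "inj_on (frac_embed R) (carrier R)"
    by (rule inj_onI) (simp add: frac_embed_def frac_eq_iff)
qed


section \<open>Pruefer domains\<close>

text \<open>\<open>inverse_ideal D I\<close> is the fractional ideal (D : I) in K, with \<open>K = frac_field D\<close>.\<close>

definition inverse_ideal :: "('a, 'm) ring_scheme \<Rightarrow> 'a set \<Rightarrow> ('a \<times> 'a) set set" where
  "inverse_ideal D I = {x \<in> carrier (frac_field D).
     \<forall>a\<in>I. x \<otimes>\<^bsub>frac_field D\<^esub> frac_embed D a \<in> frac_embed D ` carrier D}"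

text \<open>\<open>ideal_prod K A B\<close> is applied here to \<open>D\<close>-submodules of \<open>K\<close>, which are in general not ideals
  of \<open>K\<close>; it is the set of all finite sums of products of an element of \<open>A\<close> and one of \<open>B\<close>.\<close>

definition invertible_ideal :: "('a, 'm) ring_scheme \<Rightarrow> 'a set \<Rightarrow> bool" where
  "invertible_ideal D I \<longleftrightarrow> ideal I D \<and>
     ideal_prod (frac_field D) (frac_embed D ` I) (inverse_ideal D I) = frac_embed D ` carrier D"

definition prufer_domain :: "('a, 'm) ring_scheme \<Rightarrow> bool" where
  "prufer_domain D \<longleftrightarrow> domain D \<and>
     (\<forall>S. finite S \<and> S \<subseteq> carrier D \<and> Idl\<^bsub>D\<^esub> S \<noteq> {\<zero>\<^bsub>D\<^esub>} \<longrightarrow> invertible_ideal D (Idl\<^bsub>D\<^esub> S))"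


section \<open>Products of rings and height\<close>

definition product_ring :: "'i set \<Rightarrow> ('i \<Rightarrow> ('a, 'm) ring_scheme) \<Rightarrow> ('i \<Rightarrow> 'a) ring" where
  "product_ring \<Lambda> D =
    \<lparr> carrier = (\<Pi>\<^sub>E l\<in>\<Lambda>. carrier (D l)),
      monoid.mult = (\<lambda>x y. \<lambda>l\<in>\<Lambda>. x l \<otimes>\<^bsub>D l\<^esub> y l),
      monoid.one = (\<lambda>l\<in>\<Lambda>. \<one>\<^bsub>D l\<^esub>),
      ring.zero = (\<lambda>l\<in>\<Lambda>. \<zero>\<^bsub>D l\<^esub>),
      ring.add = (\<lambda>x y. \<lambda>l\<in>\<Lambda>. x l \<oplus>\<^bsub>D l\<^esub> y l) \<rparr>"

lemma cring_product_ring: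
  assumes "\<And>l. l \<in> \<Lambda> \<Longrightarrow> cring (D l)"
  shows "cring (product_ring \<Lambda> D)"
proof -
  note s = product_ring_def PiE_iff fun_eq_iff restrict_def extensional_def
  note r = cring.cring_simprules[OF assms]
  show ?thesis
  proof (rule cringI)
    show "abelian_group (product_ring \<Lambda> D)"
    proof (rule abelian_groupI)
      fix x assume "x \<in> carrier (product_ring \<Lambda> D)"
      then show "\<exists>y\<in>carrier (product_ring \<Lambda> D).
          y \<oplus>\<^bsub>product_ring \<Lambda> D\<^esub> x = \<zero>\<^bsub>product_ring \<Lambda> D\<^esub>"
        by (intro bexI[of _ "\<lambda>l\<in>\<Lambda>. \<ominus>\<^bsub>D l\<^esub> x l"]) (auto simp: s r)
    qed (auto simp: s r)
    show "comm_monoid (product_ring \<Lambda> D)"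
      by (rule comm_monoidI) (auto simp: s r monoid.r_one[OF ring.is_monoid[OF cring.axioms(1)[OF assms]]])
  qed (auto simp: s r)
qed

definition ideal_height :: "('a, 'm) ring_scheme \<Rightarrow> 'a set \<Rightarrow> enat" where
  "ideal_height R P = Sup {enat n | n. \<exists>C :: nat \<Rightarrow> 'a set.
     (\<forall>i\<le>n. primeideal (C i) R) \<and> (\<forall>i<n. C i \<subset> C (Suc i)) \<and> C n = P}"


section \<open>Ultrafilters and the ideals they define\<close>

definition ultrafilter_on :: "'b set \<Rightarrow> 'b set set \<Rightarrow> bool" where
  "ultrafilter_on S F \<longleftrightarrow> F \<subseteq> Pow S \<and> S \<in> F \<and> {} \<notin> F \<and>
     (\<forall>A\<in>F. \<forall>B\<in>F. A \<inter> B \<in> F) \<and>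
     (\<forall>A\<in>F. \<forall>B. A \<subseteq> B \<and> B \<subseteq> S \<longrightarrow> B \<in> F) \<and>
     (\<forall>A. A \<subseteq> S \<longrightarrow> A \<in> F \<or> S - A \<in> F)"

definition countably_incomplete_ultrafilter :: "'b set \<Rightarrow> 'b set set \<Rightarrow> bool" where
  "countably_incomplete_ultrafilter S F \<longleftrightarrow> ultrafilter_on S F \<and>
     (\<exists>P :: nat \<Rightarrow> 'b set. disjoint_family P \<and> (\<Union>n. P n) = S \<and> (\<forall>n. P n \<notin> F))"

definition max_ideals :: "('a, 'm) ring_scheme \<Rightarrow> 'a set set" where
  "max_ideals D = {M. maximalideal M D}"

definition max_union :: "'i set \<Rightarrow> ('i \<Rightarrow> ('a, 'm) ring_scheme) \<Rightarrow> ('i \<times> 'a set) set" where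
  "max_union \<Lambda> D = (SIGMA l:\<Lambda>. max_ideals (D l))"

definition index_trace ::
    "'i set \<Rightarrow> ('i \<Rightarrow> ('a, 'm) ring_scheme) \<Rightarrow> ('i \<times> 'a set) set \<Rightarrow> 'i set" where
  "index_trace \<Lambda> D U = {l \<in> \<Lambda>. U \<inter> ({l} \<times> max_ideals (D l)) \<noteq> {}}"

definition induced_ultrafilter ::
    "'i set \<Rightarrow> ('i \<Rightarrow> ('a, 'm) ring_scheme) \<Rightarrow> ('i \<times> 'a set) set set \<Rightarrow> 'i set set" where
  "induced_ultrafilter \<Lambda> D \<U> = index_trace \<Lambda> D ` \<U>"

definition zero_ideal_of ::
    "'i set \<Rightarrow> ('i \<Rightarrow> ('a, 'm) ring_scheme) \<Rightarrow> 'i set set \<Rightarrow> ('i \<Rightarrow> 'a) set" where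
  "zero_ideal_of \<Lambda> D F =
     {x \<in> carrier (product_ring \<Lambda> D). {l \<in> \<Lambda>. x l = \<zero>\<^bsub>D l\<^esub>} \<in> F}"

definition ultra_ideal_of ::
    "'i set \<Rightarrow> ('i \<Rightarrow> ('a, 'm) ring_scheme) \<Rightarrow> ('i \<times> 'a set) set set \<Rightarrow> ('i \<Rightarrow> 'a) set" where
  "ultra_ideal_of \<Lambda> D \<U> =
     {r \<in> carrier (product_ring \<Lambda> D). {(l, M) \<in> max_union \<Lambda> D. r l \<in> M} \<in> \<U>}"

end

(* An ultrafilter with fibres of bounded size contains a set with at most one maximal ideal M over
   each index l, so R localized at (U) behaves like an ultraproduct of the valuation rings (D l)_M.
   Given p in P but not in (0)_F, put Q = {x | p^k divides x in (D l)_M for U-almost all (l, M),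
   for every k}.  Since divisibility in a valuation ring is total, Q is prime; it omits p because
   p^2 does not divide p.  If (P n) is a partition witnessing countable incompleteness, the element
   with entries (p l)^n for l in P n lies in Q but not in (0)_F. *)
theory Submission
  imports Defs
begin

section \<open>Divisibility in a localization\<close>

text \<open>\<open>local_dvd D M a b\<close> expresses that \<open>a\<close> divides \<open>b\<close> in the localization \<open>D\<^sub>M\<close> of a domain.\<close>

definition local_dvd :: "('a, 'm) ring_scheme \<Rightarrow> 'a set \<Rightarrow> 'a \<Rightarrow> 'a \<Rightarrow> bool" where
  "local_dvd D M a b \<longleftrightarrow> (\<exists>s\<in>carrier D - M. \<exists>c\<in>carrier D. s \<otimes>\<^bsub>D\<^esub> b = a \<otimes>\<^bsub>D\<^esub> c)"

lemma (in domain) nat_pow_nonzero: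
  assumes "a \<in> carrier R" "a \<noteq> \<zero>"
  shows "a [^] (n::nat) \<noteq> \<zero>"
  using assms by (induction n) (auto simp: integral_iff)

context primeideal
begin

lemma one_notin: "\<one> \<notin> I"
  using I_notcarr one_imp_carrier by auto

lemma mult_notin:
  assumes "s \<in> carrier R - I" "t \<in> carrier R - I"
  shows "s \<otimes> t \<in> carrier R - I"
  using assms I_prime by auto

lemma local_dvd_triv:
  assumes "a \<in> carrier R" "r \<in> carrier R"
  shows "local_dvd R I a (r \<otimes> a)"
  unfolding local_dvd_def using assms one_notin
  by (intro bexI[of _ \<one>] bexI[of _ r]) (auto simp: m_comm)

lemma local_dvd_zero: "a \<in> carrier R \<Longrightarrow> local_dvd R I a \<zero>"
  using local_dvd_triv[of a \<zero>] by simp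

lemma local_dvd_mult_left:
  assumes "local_dvd R I a b" "a \<in> carrier R" "b \<in> carrier R" "r \<in> carrier R"
  shows "local_dvd R I a (r \<otimes> b)"
proof -
  obtain s c where s: "s \<in> carrier R - I" and c: "c \<in> carrier R" and e: "s \<otimes> b = a \<otimes> c"
    using assms(1) unfolding local_dvd_def by blast
  have "s \<otimes> (r \<otimes> b) = (s \<otimes> b) \<otimes> r" using s assms by (simp add: m_ac)
  also have "\<dots> = a \<otimes> (c \<otimes> r)" unfolding e using c assms by (simp add: m_ac)
  finally show ?thesis using s c assms(4) unfolding local_dvd_def by blast
qed

lemma local_dvd_mult:
  assumes "local_dvd R I a b" "local_dvd R I a' b'"
    and "a \<in> carrier R" "b \<in> carrier R" "a' \<in> carrier R" "b' \<in> carrier R"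
  shows "local_dvd R I (a \<otimes> a') (b \<otimes> b')"
proof -
  obtain s c where s: "s \<in> carrier R - I" and c: "c \<in> carrier R" and e: "s \<otimes> b = a \<otimes> c"
    using assms(1) unfolding local_dvd_def by blast
  obtain s' c' where s': "s' \<in> carrier R - I" and c': "c' \<in> carrier R" and e': "s' \<otimes> b' = a' \<otimes> c'"
    using assms(2) unfolding local_dvd_def by blast
  have "(s \<otimes> s') \<otimes> (b \<otimes> b') = (s \<otimes> b) \<otimes> (s' \<otimes> b')" using s s' assms by (simp add: m_ac)
  also have "\<dots> = (a \<otimes> a') \<otimes> (c \<otimes> c')" unfolding e e' using c c' assms by (simp add: m_ac)
  finally show ?thesis using mult_notin[OF s s'] c c' m_closed unfolding local_dvd_def by blast
qed

lemma local_dvd_add: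
  assumes "local_dvd R I a b" "local_dvd R I a b'"
    and "a \<in> carrier R" "b \<in> carrier R" "b' \<in> carrier R"
  shows "local_dvd R I a (b \<oplus> b')"
proof -
  obtain s c where s: "s \<in> carrier R - I" and c: "c \<in> carrier R" and e: "s \<otimes> b = a \<otimes> c"
    using assms(1) unfolding local_dvd_def by blast
  obtain s' c' where s': "s' \<in> carrier R - I" and c': "c' \<in> carrier R" and e': "s' \<otimes> b' = a \<otimes> c'"
    using assms(2) unfolding local_dvd_def by blast
  have "(s \<otimes> s') \<otimes> (b \<oplus> b') = s' \<otimes> (s \<otimes> b) \<oplus> s \<otimes> (s' \<otimes> b')"
    using s s' assms by (simp add: m_ac r_distr)
  also have "\<dots> = a \<otimes> (s' \<otimes> c \<oplus> s \<otimes> c')"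
    unfolding e e' using c c' s s' assms by (simp add: m_ac r_distr)
  finally show ?thesis using mult_notin[OF s s'] s s' c c' unfolding local_dvd_def
    by (intro bexI[of _ "s \<otimes> s'"] bexI[of _ "s' \<otimes> c \<oplus> s \<otimes> c'"]) auto
qed

lemma local_dvd_trans:
  assumes "local_dvd R I a b" "local_dvd R I b d"
    and "a \<in> carrier R" "b \<in> carrier R" "d \<in> carrier R"
  shows "local_dvd R I a d"
proof -
  obtain s c where s: "s \<in> carrier R - I" and c: "c \<in> carrier R" and e: "s \<otimes> b = a \<otimes> c"
    using assms(1) unfolding local_dvd_def by blast
  obtain s' c' where s': "s' \<in> carrier R - I" and c': "c' \<in> carrier R" and e': "s' \<otimes> d = b \<otimes> c'"
    using assms(2) unfolding local_dvd_def by blast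
  have "(s \<otimes> s') \<otimes> d = s \<otimes> (s' \<otimes> d)" using s s' assms by (simp add: m_ac)
  also have "\<dots> = (s \<otimes> b) \<otimes> c'" unfolding e' using s c' assms by (simp add: m_ac)
  also have "\<dots> = a \<otimes> (c \<otimes> c')" unfolding e using c c' assms by (simp add: m_ac)
  finally show ?thesis using mult_notin[OF s s'] c c' m_closed unfolding local_dvd_def by blast
qed

lemma local_dvd_pow_le:
  assumes "p \<in> carrier R" "j \<le> (k::nat)"
  shows "local_dvd R I (p [^] j) (p [^] k)"
proof -
  have "p [^] k = p [^] (k - j) \<otimes> p [^] j" using assms by (simp add: nat_pow_mult)
  then show ?thesis using local_dvd_triv[of "p [^] j" "p [^] (k - j)"] assms by simp
qed

text \<open>In a domain \<open>p [^] k\<close> can be cancelled, and then the denominator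
  \<open>s\<close> becomes a multiple of \<open>p\<close>, hence an element of \<open>I\<close>,
  which denominators must avoid.\<close>

lemma not_local_dvd_pow_Suc:
  assumes "domain R" "p \<in> I" "p \<noteq> \<zero>"
  shows "\<not> local_dvd R I (p [^] Suc k) (p [^] (k::nat))"
proof
  interpret R: domain R by fact
  have p: "p \<in> carrier R" using assms(2) by (rule a_Hcarr)
  assume "local_dvd R I (p [^] Suc k) (p [^] k)"
  then obtain s c where s: "s \<in> carrier R - I" and c: "c \<in> carrier R"
    and e: "s \<otimes> p [^] k = p [^] Suc k \<otimes> c" unfolding local_dvd_def by blast
  have "p [^] k \<otimes> s = p [^] k \<otimes> (p \<otimes> c)" using e s c p by (simp add: m_ac)
  moreover have "p [^] k \<noteq> \<zero>" using p assms(3) by (rule R.nat_pow_nonzero)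
  ultimately have "s = p \<otimes> c" using R.m_lcancel s c p by auto
  then show False using s c assms(2) I_r_closed by auto
qed

end

text \<open>This says that the localization at \<open>M\<close> is a valuation ring. The ideal
  generated by \<open>a\<close> and \<open>b\<close> is invertible; if every \<open>y\<close> in its
  inverse sent both generators into \<open>M\<close>, the product with the inverse would stay inside
  \<open>M\<close> and miss \<open>\<one>\<close>. So some \<open>y\<close> gives
  \<open>u = y a\<close> or \<open>v = y b\<close> outside \<open>M\<close>. Since
  \<open>u b\<close> and \<open>a v\<close> both equal \<open>y a b\<close>, that element serves as
  a denominator.\<close>

lemma prufer_local_dvd_total:
  assumes pr: "prufer_domain D" and M: "maximalideal M D"
    and ab: "a \<in> carrier D" "b \<in> carrier D"
  shows "local_dvd D M a b \<or> local_dvd D M b a"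
proof -
  interpret domain D using pr by (simp add: prufer_domain_def)
  interpret M: maximalideal M D by fact
  interpret M: primeideal M D using M by (rule maximalideal_prime)
  show ?thesis
  \<comment> \<open>Invertibility is assumed for nonzero ideals only; zero is divisible by
    everything.\<close>
  proof (cases "a = \<zero>\<^bsub>D\<^esub> \<or> b = \<zero>\<^bsub>D\<^esub>")
    case True
    then show ?thesis using ab M.local_dvd_zero by auto
  next
    case False
    define K where "K = frac_field D"
    interpret K: field K unfolding K_def by (rule field_frac_field)
    interpret h: ring_hom_ring D K "frac_embed D"
      by (rule ring_hom_ringI2) (use frac_embed_hom K.ring_axioms ring_axioms in \<open>auto simp: K_def\<close>)
    let ?I = "Idl\<^bsub>D\<^esub> {a, b}"
    let ?J = "inverse_ideal D ?I"
    have abI: "a \<in> ?I" "b \<in> ?I" using genideal_self[of "{a, b}"] ab by auto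
    then have "?I \<noteq> {\<zero>\<^bsub>D\<^esub>}" using False by auto
    then have prod: "ideal_prod K (frac_embed D ` ?I) ?J = frac_embed D ` carrier D"
      using pr ab by (auto simp: prufer_domain_def invertible_ideal_def K_def)
    \<comment> \<open>\<open>Idl\<close> is an intersection of ideals; the sum of principal ideals
      exposes the coefficients \<open>w\<close> and \<open>z\<close> used in the induction
      below.\<close>
    have I: "?I = PIdl\<^bsub>D\<^esub> a <+>\<^bsub>D\<^esub> PIdl\<^bsub>D\<^esub> b"
    proof
      have "ideal (PIdl\<^bsub>D\<^esub> a <+>\<^bsub>D\<^esub> PIdl\<^bsub>D\<^esub> b) D"
        by (intro add_ideals cgenideal_ideal ab)
      moreover have "a \<oplus>\<^bsub>D\<^esub> \<zero>\<^bsub>D\<^esub> \<in> PIdl\<^bsub>D\<^esub> a <+>\<^bsub>D\<^esub> PIdl\<^bsub>D\<^esub> b"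
          "\<zero>\<^bsub>D\<^esub> \<oplus>\<^bsub>D\<^esub> b \<in> PIdl\<^bsub>D\<^esub> a <+>\<^bsub>D\<^esub> PIdl\<^bsub>D\<^esub> b"
        using cgenideal_self[of a] cgenideal_self[of b] ab cgenideal_ideal
          additive_subgroup.zero_closed[OF ideal.axioms(1)]
        unfolding set_add_def' by blast+
      ultimately show "?I \<subseteq> PIdl\<^bsub>D\<^esub> a <+>\<^bsub>D\<^esub> PIdl\<^bsub>D\<^esub> b"
        using ab by (intro genideal_minimal) auto
      interpret J: ideal ?I D using ab by (intro genideal_ideal) auto
      show "PIdl\<^bsub>D\<^esub> a <+>\<^bsub>D\<^esub> PIdl\<^bsub>D\<^esub> b \<subseteq> ?I"
        using abI J.I_l_closed J.a_closed by (auto simp: set_add_def' cgenideal_def)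
    qed
    have J: "\<exists>u\<in>carrier D. y \<otimes>\<^bsub>K\<^esub> frac_embed D c = frac_embed D u"
      if "y \<in> ?J" "c \<in> ?I" for y c
      using that by (auto simp: inverse_ideal_def K_def)
    have Jc: "y \<in> carrier K" if "y \<in> ?J" for y
      using that by (auto simp: inverse_ideal_def K_def)
    have "\<exists>y\<in>?J. \<exists>u v. u \<in> carrier D \<and> v \<in> carrier D \<and> (u \<notin> M \<or> v \<notin> M) \<and>
        y \<otimes>\<^bsub>K\<^esub> frac_embed D a = frac_embed D u \<and> y \<otimes>\<^bsub>K\<^esub> frac_embed D b = frac_embed D v"
    proof (rule ccontr)
      assume neg: "\<not> ?thesis"
      \<comment> \<open>\<open>ideal_prod\<close> is generated inductively by products and sums, so
        it suffices that each generating product lands in the image of \<open>M\<close>.\<close>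
      have "t \<in> frac_embed D ` M" if "t \<in> ideal_prod K (frac_embed D ` ?I) ?J" for t
        using that
      proof induction
        case (prod i y)
        then obtain w z where wz: "w \<in> carrier D" "z \<in> carrier D"
          and i: "i = frac_embed D (w \<otimes>\<^bsub>D\<^esub> a \<oplus>\<^bsub>D\<^esub> z \<otimes>\<^bsub>D\<^esub> b)"
          unfolding I by (auto simp: set_add_def' cgenideal_def)
        obtain u v where uv: "u \<in> carrier D" "v \<in> carrier D"
          and eq: "y \<otimes>\<^bsub>K\<^esub> frac_embed D a = frac_embed D u" "y \<otimes>\<^bsub>K\<^esub> frac_embed D b = frac_embed D v"
          using J[OF prod(2) abI(1)] J[OF prod(2) abI(2)] by blast
        then have uvM: "u \<in> M" "v \<in> M" using neg prod(2) by blast+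
        have "i \<otimes>\<^bsub>K\<^esub> y = frac_embed D w \<otimes>\<^bsub>K\<^esub> (y \<otimes>\<^bsub>K\<^esub> frac_embed D a)
            \<oplus>\<^bsub>K\<^esub> frac_embed D z \<otimes>\<^bsub>K\<^esub> (y \<otimes>\<^bsub>K\<^esub> frac_embed D b)"
          unfolding i using wz ab Jc[OF prod(2)] by (simp add: K.m_ac K.r_distr K.l_distr)
        also have "\<dots> = frac_embed D (w \<otimes>\<^bsub>D\<^esub> u \<oplus>\<^bsub>D\<^esub> z \<otimes>\<^bsub>D\<^esub> v)"
          unfolding eq using wz uv by simp
        finally show ?case using wz uvM M.I_l_closed M.a_closed by blast
      next
        case (sum s t)
        then obtain s' t' where "s' \<in> M" "t' \<in> M" "s = frac_embed D s'" "t = frac_embed D t'" by blast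
        then show ?case using M.a_closed[of s' t'] M.a_Hcarr
          by (intro image_eqI[of _ _ "s' \<oplus>\<^bsub>D\<^esub> t'"]) auto
      qed
      then have "frac_embed D \<one>\<^bsub>D\<^esub> \<in> frac_embed D ` M" unfolding prod by blast
      then have "\<one>\<^bsub>D\<^esub> \<in> M" using inj_on_image_mem_iff[OF frac_embed_inj one_closed M.a_subset] by blast
      then show False using M.one_notin by simp
    qed
    then obtain y u v where y: "y \<in> ?J" and uv: "u \<in> carrier D" "v \<in> carrier D"
      and uvM: "u \<notin> M \<or> v \<notin> M"
      and eq: "y \<otimes>\<^bsub>K\<^esub> frac_embed D a = frac_embed D u" "y \<otimes>\<^bsub>K\<^esub> frac_embed D b = frac_embed D v"
      by blast
    have "frac_embed D (u \<otimes>\<^bsub>D\<^esub> b) = (y \<otimes>\<^bsub>K\<^esub> frac_embed D a) \<otimes>\<^bsub>K\<^esub> frac_embed D b"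
      unfolding eq using uv ab by simp
    also have "\<dots> = frac_embed D a \<otimes>\<^bsub>K\<^esub> (y \<otimes>\<^bsub>K\<^esub> frac_embed D b)"
      using Jc[OF y] ab by (simp add: K.m_ac)
    also have "\<dots> = frac_embed D (a \<otimes>\<^bsub>D\<^esub> v)" unfolding eq using uv ab by simp
    finally have "u \<otimes>\<^bsub>D\<^esub> b = a \<otimes>\<^bsub>D\<^esub> v" using frac_embed_inj uv ab by (auto simp: inj_on_def)
    moreover from this have "v \<otimes>\<^bsub>D\<^esub> a = b \<otimes>\<^bsub>D\<^esub> u" using uv ab by (simp add: m_comm)
    ultimately show ?thesis using uv uvM unfolding local_dvd_def by blast
  qed
qed


section \<open>Ultrafilters\<close>

lemma ultrafilter_mono:
  "ultrafilter_on S F \<Longrightarrow> A \<in> F \<Longrightarrow> A \<subseteq> B \<Longrightarrow> B \<subseteq> S \<Longrightarrow> B \<in> F"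
  unfolding ultrafilter_on_def by blast

lemma ultrafilter_Int: "ultrafilter_on S F \<Longrightarrow> A \<in> F \<Longrightarrow> B \<in> F \<Longrightarrow> A \<inter> B \<in> F"
  unfolding ultrafilter_on_def by blast

lemma ultrafilter_subset: "ultrafilter_on S F \<Longrightarrow> A \<in> F \<Longrightarrow> A \<subseteq> S"
  unfolding ultrafilter_on_def by blast

lemma ultrafilter_nonempty: "ultrafilter_on S F \<Longrightarrow> A \<in> F \<Longrightarrow> A \<noteq> {}"
  unfolding ultrafilter_on_def by blast

lemma ultrafilter_compl: "ultrafilter_on S F \<Longrightarrow> A \<subseteq> S \<Longrightarrow> A \<notin> F \<Longrightarrow> S - A \<in> F"
  unfolding ultrafilter_on_def by blast

lemma ultrafilter_Un:
  assumes "ultrafilter_on S F" "A \<subseteq> S" "B \<subseteq> S" "A \<union> B \<in> F"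
  shows "A \<in> F \<or> B \<in> F"
proof (rule disjCI)
  assume "B \<notin> F"
  then have "S - B \<in> F" by (rule ultrafilter_compl[OF assms(1,3)])
  then have "(A \<union> B) \<inter> (S - B) \<in> F" by (rule ultrafilter_Int[OF assms(1,4)])
  then show "A \<in> F" by (rule ultrafilter_mono[OF assms(1)]) (use assms(2) in auto)
qed

text \<open>Peel off one point from every nonempty fibre. Either these points form a member of the
  ultrafilter, on which \<open>f\<close> is injective, or the remainder is a member and its fibre
  bound has dropped by one. Finiteness is stated separately because \<open>card\<close> of an
  infinite set is 0.\<close>

lemma ultrafilter_section:
  assumes "ultrafilter_on S F" "Y \<in> F"
    and "\<And>l. finite {z\<in>Y. f z = l} \<and> card {z\<in>Y. f z = l} \<le> N"
  shows "\<exists>Z\<in>F. inj_on f Z"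
  using assms(2,3)
proof (induction N arbitrary: Y)
  case 0
  then have "\<And>l. {z\<in>Y. f z = l} = {}" by (metis card_0_eq le_zero_eq)
  then have "Y = {}" by blast
  then show ?case using 0 ultrafilter_nonempty[OF assms(1)] by blast
next
  case (Suc N)
  define g where "g l = (SOME z. z \<in> Y \<and> f z = l)" for l
  define Z where "Z = g ` f ` Y"
  have g: "g (f z) \<in> Y \<and> f (g (f z)) = f z" if "z \<in> Y" for z
    unfolding g_def by (rule someI_ex) (use that in blast)
  have "Z \<subseteq> Y" using g by (auto simp: Z_def)
  have inj: "inj_on f Z" using g by (auto simp: Z_def inj_on_def)
  have "Z \<in> F \<or> Y - Z \<in> F"
  proof (rule ultrafilter_Un[OF assms(1)])
    show "Z \<subseteq> S" "Y - Z \<subseteq> S"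
      using \<open>Z \<subseteq> Y\<close> ultrafilter_subset[OF assms(1) Suc.prems(1)] by auto
    show "Z \<union> (Y - Z) \<in> F"
      using \<open>Z \<subseteq> Y\<close> Suc.prems(1) by (simp add: Un_absorb1)
  qed
  then show ?case
  proof
    assume "Y - Z \<in> F"
    then show ?thesis
    proof (rule Suc.IH)
      fix l
      have fin: "finite {z\<in>Y. f z = l}" and le: "card {z\<in>Y. f z = l} \<le> Suc N"
        using Suc.prems(2)[of l] by auto
      show "finite {z\<in>Y - Z. f z = l} \<and> card {z\<in>Y - Z. f z = l} \<le> N"
      proof (cases "{z\<in>Y. f z = l} = {}")
        case True
        then have "{z\<in>Y - Z. f z = l} = {}" by blast
        then show ?thesis by (metis card.empty finite.emptyI le0)
      next
        case False
        then obtain z where z: "z \<in> Y" "f z = l" by blast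
        then have "g l \<in> {z\<in>Y. f z = l}" "g l \<in> Z" using g[of z] by (auto simp: Z_def)
        then have "{z\<in>Y - Z. f z = l} \<subset> {z\<in>Y. f z = l}" by blast
        then have "card {z\<in>Y - Z. f z = l} < card {z\<in>Y. f z = l}"
          by (rule psubset_card_mono[OF fin])
        moreover have "finite {z\<in>Y - Z. f z = l}" by (rule finite_subset[OF _ fin]) blast
        ultimately show ?thesis using le by linarith
      qed
    qed
  qed (use inj in blast)
qed

text \<open>Let \<open>n l\<close> be the number of a block of the partition containing
  \<open>l\<close>. Each block has its complement in \<open>F\<close>, so removing the blocks below
  \<open>k\<close> one by one leaves a member of \<open>F\<close>. In the ultrapower of the
  naturals, \<open>n\<close> represents an infinite element.\<close>

lemma ultrafilter_index:
  assumes "countably_incomplete_ultrafilter S F"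
  shows "\<exists>n :: 'b \<Rightarrow> nat. \<forall>k. {l\<in>S. k \<le> n l} \<in> F"
proof -
  have uf: "ultrafilter_on S F"
    using assms by (simp add: countably_incomplete_ultrafilter_def)
  obtain P :: "nat \<Rightarrow> 'b set" where P: "(\<Union>n. P n) = S" "\<forall>n. P n \<notin> F"
    using assms unfolding countably_incomplete_ultrafilter_def by - (elim conjE exE, rule that)
  define n where "n l = (LEAST n. l \<in> P n)" for l
  have n: "l \<in> P (n l)" if "l \<in> S" for l
    unfolding n_def by (rule LeastI_ex) (use that P(1) in blast)
  have "{l\<in>S. k \<le> n l} \<in> F" for k
  proof (induction k)
    case 0
    then show ?case using uf by (simp add: ultrafilter_on_def)
  next
    case (Suc k)
    have "S - P k \<in> F" using ultrafilter_compl[OF uf] P by blast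
    with Suc have "{l\<in>S. k \<le> n l} \<inter> (S - P k) \<in> F" by (rule ultrafilter_Int[OF uf])
    \<comment> \<open>As \<open>l\<close> lies in block \<open>n l\<close>, leaving block
      \<open>k\<close> excludes \<open>n l = k\<close>.\<close>
    moreover have "{l\<in>S. k \<le> n l} \<inter> (S - P k) \<subseteq> {l\<in>S. Suc k \<le> n l}"
      using n by (force simp: Suc_le_eq le_less)
    ultimately show ?case by (rule ultrafilter_mono[OF uf]) auto
  qed
  then show ?thesis by blast
qed

text \<open>The induced ultrafilter is the pushforward of \<open>\<U>\<close> along the index map
  \<open>fst\<close>, so conditions on indices can be tested on maximal ideals. Each
  \<open>V\<close> lies over its own trace, and the trace of the full preimage of \<open>A\<close>
  lies inside \<open>A\<close>; upward closure does the rest.\<close>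

lemma mem_induced_ultrafilter_iff:
  assumes "ultrafilter_on (max_union \<Lambda> D) \<U>" "ultrafilter_on \<Lambda> (induced_ultrafilter \<Lambda> D \<U>)"
    and "A \<subseteq> \<Lambda>"
  shows "A \<in> induced_ultrafilter \<Lambda> D \<U> \<longleftrightarrow> {z \<in> max_union \<Lambda> D. fst z \<in> A} \<in> \<U>"
proof
  assume "A \<in> induced_ultrafilter \<Lambda> D \<U>"
  then obtain V where V: "V \<in> \<U>" "A = index_trace \<Lambda> D V"
    by (auto simp: induced_ultrafilter_def)
  have "V \<subseteq> max_union \<Lambda> D" using assms(1) V by (simp add: ultrafilter_subset)
  then have "V \<subseteq> {z \<in> max_union \<Lambda> D. fst z \<in> A}"
    unfolding V(2) index_trace_def max_union_def by fastforce
  then show "{z \<in> max_union \<Lambda> D. fst z \<in> A} \<in> \<U>"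
    using ultrafilter_mono[OF assms(1) V(1)] by auto
next
  assume "{z \<in> max_union \<Lambda> D. fst z \<in> A} \<in> \<U>"
  then have "index_trace \<Lambda> D {z \<in> max_union \<Lambda> D. fst z \<in> A} \<in> induced_ultrafilter \<Lambda> D \<U>"
    unfolding induced_ultrafilter_def by blast
  moreover have "index_trace \<Lambda> D {z \<in> max_union \<Lambda> D. fst z \<in> A} \<subseteq> A"
    by (auto simp: index_trace_def)
  ultimately show "A \<in> induced_ultrafilter \<Lambda> D \<U>"
    using ultrafilter_mono[OF assms(2)] assms(3) by blast
qed


section \<open>Elements divisible by all powers\<close>

text \<open>The preimage in the product ring of the intersection of all ideals generated by a power
  of \<open>p\<close> in the ultraproduct of the localizations. The quantifier over \<open>k\<close>
  stands outside the membership in \<open>\<U>\<close>, so the exceptional set may depend on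
  \<open>k\<close>.\<close>

definition power_divisible ::
    "'i set \<Rightarrow> ('i \<Rightarrow> ('a, 'm) ring_scheme) \<Rightarrow> ('i \<times> 'a set) set set \<Rightarrow> ('i \<Rightarrow> 'a) \<Rightarrow> ('i \<Rightarrow> 'a) set"
  where
  "power_divisible \<Lambda> D \<U> p = {x \<in> carrier (product_ring \<Lambda> D).
     \<forall>k::nat. {z \<in> max_union \<Lambda> D.
       local_dvd (D (fst z)) (snd z) (p (fst z) [^]\<^bsub>D (fst z)\<^esub> k) (x (fst z))} \<in> \<U>}"

section \<open>Products of Pruefer domains with an ultrafilter on the maximal ideals\<close>

locale prufer_ultraproduct =
  fixes \<Lambda> :: "'i set" and D :: "'i \<Rightarrow> ('a, 'm) ring_scheme" and \<U> :: "('i \<times> 'a set) set set"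
  assumes prufer: "l \<in> \<Lambda> \<Longrightarrow> prufer_domain (D l)"
    and U: "ultrafilter_on (max_union \<Lambda> D) \<U>"
begin

abbreviation R :: "('i \<Rightarrow> 'a) ring" where "R \<equiv> product_ring \<Lambda> D"
abbreviation maxs :: "('i \<times> 'a set) set" where "maxs \<equiv> max_union \<Lambda> D"

lemma domain_component: "l \<in> \<Lambda> \<Longrightarrow> domain (D l)"
  using prufer by (simp add: prufer_domain_def)

lemma cring_R: "cring R"
  by (intro cring_product_ring domain.axioms(1) domain_component)

lemma component: "x \<in> carrier R \<Longrightarrow> l \<in> \<Lambda> \<Longrightarrow> x l \<in> carrier (D l)"
  by (auto simp: product_ring_def)

lemma R_simps:
  "l \<in> \<Lambda> \<Longrightarrow> (x \<otimes>\<^bsub>R\<^esub> y) l = x l \<otimes>\<^bsub>D l\<^esub> y l"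
  "l \<in> \<Lambda> \<Longrightarrow> (x \<oplus>\<^bsub>R\<^esub> y) l = x l \<oplus>\<^bsub>D l\<^esub> y l"
  "l \<in> \<Lambda> \<Longrightarrow> \<zero>\<^bsub>R\<^esub> l = \<zero>\<^bsub>D l\<^esub>"
  by (auto simp: product_ring_def)

lemma maximal: "z \<in> maxs \<Longrightarrow> fst z \<in> \<Lambda>" "z \<in> maxs \<Longrightarrow> maximalideal (snd z) (D (fst z))"
  by (auto simp: max_union_def max_ideals_def)

lemma prime: "z \<in> maxs \<Longrightarrow> primeideal (snd z) (D (fst z))"
  by (intro cring.maximalideal_prime domain.axioms(1) domain_component maximal)

text \<open>This rule and the next two treat \<open>{z\<in>maxs. \<phi> z} \<in> \<U>\<close> as the
  quantifier "for almost all \<open>z\<close>".\<close>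

lemma almost_mono:
  assumes "{z\<in>maxs. \<phi> z} \<in> \<U>" "\<And>z. z \<in> maxs \<Longrightarrow> \<phi> z \<Longrightarrow> \<psi> z"
  shows "{z\<in>maxs. \<psi> z} \<in> \<U>"
  by (rule ultrafilter_mono[OF U assms(1)]) (auto dest: assms(2))

lemma almost_mono2:
  assumes "{z\<in>maxs. \<phi> z} \<in> \<U>" "{z\<in>maxs. \<chi> z} \<in> \<U>" "\<And>z. z \<in> maxs \<Longrightarrow> \<phi> z \<Longrightarrow> \<chi> z \<Longrightarrow> \<psi> z"
  shows "{z\<in>maxs. \<psi> z} \<in> \<U>"
  by (rule ultrafilter_mono[OF U ultrafilter_Int[OF U assms(1,2)]]) (auto dest: assms(3))

lemma almost_not: "{z\<in>maxs. \<phi> z} \<notin> \<U> \<Longrightarrow> {z\<in>maxs. \<not> \<phi> z} \<in> \<U>"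
  using ultrafilter_compl[OF U, of "{z\<in>maxs. \<phi> z}"] by (simp add: set_diff_eq cong: conj_cong)

lemma almost_D:
  assumes "x \<in> power_divisible \<Lambda> D \<U> p"
  shows "{z\<in>maxs. local_dvd (D (fst z)) (snd z) (p (fst z) [^]\<^bsub>D (fst z)\<^esub> (k::nat)) (x (fst z))} \<in> \<U>"
    and "x \<in> carrier R"
  using assms by (auto simp: power_divisible_def)

lemma ultra_ideal_alt: "ultra_ideal_of \<Lambda> D \<U> = {r \<in> carrier R. {z\<in>maxs. r (fst z) \<in> snd z} \<in> \<U>}"
  unfolding ultra_ideal_of_def by (simp add: case_prod_unfold)

lemma pow_component: "p \<in> carrier R \<Longrightarrow> l \<in> \<Lambda> \<Longrightarrow> p l [^]\<^bsub>D l\<^esub> (k::nat) \<in> carrier (D l)"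
  by (intro monoid.nat_pow_closed ring.is_monoid cring.axioms(1) domain.axioms(1)
      domain_component component)

lemma ideal_power_divisible:
  assumes p: "p \<in> carrier R"
  shows "ideal (power_divisible \<Lambda> D \<U> p) R"
proof -
  interpret cring R by (rule cring_R)
  let ?Q = "power_divisible \<Lambda> D \<U> p"
  note c = component maximal(1) pow_component[OF p]
  have mult: "r \<otimes>\<^bsub>R\<^esub> x \<in> ?Q" if x: "x \<in> ?Q" and r: "r \<in> carrier R" for x r
    unfolding power_divisible_def mem_Collect_eq
  proof (intro conjI allI)
    fix k :: nat
    show "{z\<in>maxs. local_dvd (D (fst z)) (snd z) (p (fst z) [^]\<^bsub>D (fst z)\<^esub> k) ((r \<otimes>\<^bsub>R\<^esub> x) (fst z))} \<in> \<U>"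
      by (rule almost_mono[OF almost_D(1)[OF x, of k]])
        (simp add: R_simps c r almost_D(2)[OF x] primeideal.local_dvd_mult_left[OF prime])
  qed (use x r almost_D(2) in auto)
  have add: "x \<oplus>\<^bsub>R\<^esub> y \<in> ?Q" if x: "x \<in> ?Q" and y: "y \<in> ?Q" for x y
    unfolding power_divisible_def mem_Collect_eq
  proof (intro conjI allI)
    fix k :: nat
    show "{z\<in>maxs. local_dvd (D (fst z)) (snd z) (p (fst z) [^]\<^bsub>D (fst z)\<^esub> k) ((x \<oplus>\<^bsub>R\<^esub> y) (fst z))} \<in> \<U>"
      by (rule almost_mono2[OF almost_D(1)[OF x, of k] almost_D(1)[OF y, of k]])
        (simp add: R_simps c almost_D(2)[OF x] almost_D(2)[OF y] primeideal.local_dvd_add[OF prime])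
  qed (use x y almost_D(2) in auto)
  have zero: "\<zero>\<^bsub>R\<^esub> \<in> ?Q"
    unfolding power_divisible_def mem_Collect_eq
  proof (intro conjI allI)
    fix k :: nat
    have "{z\<in>maxs. True} \<in> \<U>" using U by (simp add: ultrafilter_on_def)
    then show "{z\<in>maxs. local_dvd (D (fst z)) (snd z) (p (fst z) [^]\<^bsub>D (fst z)\<^esub> k) (\<zero>\<^bsub>R\<^esub> (fst z))} \<in> \<U>"
      by (rule almost_mono) (simp add: R_simps c primeideal.local_dvd_zero[OF prime])
  qed auto
  have sub: "?Q \<subseteq> carrier R" by (auto simp: power_divisible_def)
  show ?thesis
  proof (rule idealI)
    show "subgroup ?Q (add_monoid R)"
    proof (rule add.subgroupI)
      fix x assume x: "x \<in> ?Q"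
      \<comment> \<open>Negation becomes a case of closure under multiplication by ring
        elements.\<close>
      then have "\<ominus>\<^bsub>R\<^esub> x = (\<ominus>\<^bsub>R\<^esub> \<one>\<^bsub>R\<^esub>) \<otimes>\<^bsub>R\<^esub> x" using sub by (auto simp: l_minus)
      then show "\<ominus>\<^bsub>R\<^esub> x \<in> ?Q" using mult[OF x, of "\<ominus>\<^bsub>R\<^esub> \<one>\<^bsub>R\<^esub>"] by simp
    qed (use sub zero add in auto)
    fix x r assume x: "x \<in> ?Q" and r: "r \<in> carrier R"
    show "r \<otimes>\<^bsub>R\<^esub> x \<in> ?Q" by (rule mult[OF x r])
    then show "x \<otimes>\<^bsub>R\<^esub> r \<in> ?Q" using x r sub m_comm[of x r] by auto
  qed (rule ring_axioms)
qed

text \<open>For almost all \<open>(l, M)\<close> the entry of \<open>p\<close> is a nonzero element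
  of \<open>M\<close>, where the next power never divides the previous one. The case
  \<open>k = 1\<close> keeps \<open>p\<close> out of the ideal; arbitrary \<open>k\<close> is needed
  for primality.\<close>

lemma self_notin_power_divisible:
  assumes p: "p \<in> ultra_ideal_of \<Lambda> D \<U>" and nz: "{z\<in>maxs. p (fst z) = \<zero>\<^bsub>D (fst z)\<^esub>} \<notin> \<U>"
  shows "{z\<in>maxs. local_dvd (D (fst z)) (snd z) (p (fst z) [^]\<^bsub>D (fst z)\<^esub> Suc k)
      (p (fst z) [^]\<^bsub>D (fst z)\<^esub> (k::nat))} \<notin> \<U>"
proof
  have 1: "{z\<in>maxs. p (fst z) \<in> snd z} \<in> \<U>" using p by (simp add: ultra_ideal_alt)
  assume 2: "{z\<in>maxs. local_dvd (D (fst z)) (snd z) (p (fst z) [^]\<^bsub>D (fst z)\<^esub> Suc k)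
      (p (fst z) [^]\<^bsub>D (fst z)\<^esub> k)} \<in> \<U>"
  have 3: "{z\<in>maxs. \<not> local_dvd (D (fst z)) (snd z) (p (fst z) [^]\<^bsub>D (fst z)\<^esub> Suc k)
      (p (fst z) [^]\<^bsub>D (fst z)\<^esub> k)} \<in> \<U>"
    by (rule almost_mono2[OF 1 almost_not[OF nz]])
      (metis primeideal.not_local_dvd_pow_Suc prime domain_component maximal(1))
  have "{z\<in>maxs. False} \<in> \<U>" by (rule almost_mono2[OF 2 3]) auto
  then show False using ultrafilter_nonempty[OF U] by blast
qed

text \<open>By totality, an element outside the ideal divides some power of \<open>p\<close> almost
  everywhere. If \<open>a\<close> and \<open>b\<close> divide the powers \<open>j\<close> and
  \<open>k\<close>, then \<open>a b\<close> divides the power \<open>j + k\<close>; were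
  \<open>a b\<close> in the ideal, the power \<open>j + k + 1\<close> would divide the power
  \<open>j + k\<close>.\<close>

lemma primeideal_power_divisible:
  assumes p: "p \<in> ultra_ideal_of \<Lambda> D \<U>" and nz: "{z\<in>maxs. p (fst z) = \<zero>\<^bsub>D (fst z)\<^esub>} \<notin> \<U>"
  shows "primeideal (power_divisible \<Lambda> D \<U> p) R"
    and "p \<notin> power_divisible \<Lambda> D \<U> p"
proof -
  let ?Q = "power_divisible \<Lambda> D \<U> p"
  have pc: "p \<in> carrier R" using p by (simp add: ultra_ideal_alt)
  note c = component maximal(1) pow_component[OF pc]
  show pQ: "p \<notin> ?Q"
  proof
    assume "p \<in> ?Q"
    then have "{z\<in>maxs. local_dvd (D (fst z)) (snd z) (p (fst z) [^]\<^bsub>D (fst z)\<^esub> Suc 1) (p (fst z))} \<in> \<U>"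
      by (rule almost_D(1))
    \<comment> \<open>Writing \<open>p\<close> as its first power matches the shape with exponents
      \<open>Suc k\<close> and \<open>k\<close> at \<open>k = 1\<close>.\<close>
    then have "{z\<in>maxs. local_dvd (D (fst z)) (snd z) (p (fst z) [^]\<^bsub>D (fst z)\<^esub> Suc 1)
        (p (fst z) [^]\<^bsub>D (fst z)\<^esub> (1::nat))} \<in> \<U>"
    proof (rule almost_mono)
      fix z assume z: "z \<in> maxs"
      interpret domain "D (fst z)" by (rule domain_component[OF maximal(1)[OF z]])
      assume "local_dvd (D (fst z)) (snd z) (p (fst z) [^]\<^bsub>D (fst z)\<^esub> Suc 1) (p (fst z))"
      moreover have "p (fst z) [^]\<^bsub>D (fst z)\<^esub> (1::nat) = p (fst z)"
        using component[OF pc maximal(1)[OF z]] by (rule nat_pow_eone)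
      ultimately show "local_dvd (D (fst z)) (snd z) (p (fst z) [^]\<^bsub>D (fst z)\<^esub> Suc 1)
        (p (fst z) [^]\<^bsub>D (fst z)\<^esub> (1::nat))" by (simp only:)
    qed
    then show False using self_notin_power_divisible[OF p nz] by blast
  qed
  have small: "\<exists>k::nat. {z\<in>maxs. local_dvd (D (fst z)) (snd z) (a (fst z)) (p (fst z) [^]\<^bsub>D (fst z)\<^esub> k)} \<in> \<U>"
    if a: "a \<in> carrier R" "a \<notin> ?Q" for a
  proof -
    obtain k :: nat where "{z\<in>maxs. local_dvd (D (fst z)) (snd z) (p (fst z) [^]\<^bsub>D (fst z)\<^esub> k) (a (fst z))} \<notin> \<U>"
      using a by (auto simp: power_divisible_def)
    then have "{z\<in>maxs. local_dvd (D (fst z)) (snd z) (a (fst z)) (p (fst z) [^]\<^bsub>D (fst z)\<^esub> k)} \<in> \<U>"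
      by (rule almost_mono[OF almost_not]) (use prufer_local_dvd_total prufer maximal c a(1) in metis)
    then show ?thesis by blast
  qed
  show "primeideal ?Q R"
  proof (rule primeidealI[OF ideal_power_divisible[OF pc] cring_R])
    show "carrier R \<noteq> ?Q" using pc pQ by auto
    fix a b assume a: "a \<in> carrier R" and b: "b \<in> carrier R" and ab: "a \<otimes>\<^bsub>R\<^esub> b \<in> ?Q"
    show "a \<in> ?Q \<or> b \<in> ?Q"
    proof (rule ccontr)
      assume "\<not> ?thesis"
      then obtain j k :: nat
        where j: "{z\<in>maxs. local_dvd (D (fst z)) (snd z) (a (fst z)) (p (fst z) [^]\<^bsub>D (fst z)\<^esub> j)} \<in> \<U>"
          and k: "{z\<in>maxs. local_dvd (D (fst z)) (snd z) (b (fst z)) (p (fst z) [^]\<^bsub>D (fst z)\<^esub> k)} \<in> \<U>"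
        using small a b by meson
      have "{z\<in>maxs. local_dvd (D (fst z)) (snd z) ((a \<otimes>\<^bsub>R\<^esub> b) (fst z)) (p (fst z) [^]\<^bsub>D (fst z)\<^esub> (j + k))} \<in> \<U>"
      proof (rule almost_mono2[OF j k])
        fix z assume z: "z \<in> maxs"
        interpret domain "D (fst z)" by (rule domain_component[OF maximal(1)[OF z]])
        have e: "p (fst z) [^]\<^bsub>D (fst z)\<^esub> (j + k)
            = p (fst z) [^]\<^bsub>D (fst z)\<^esub> j \<otimes>\<^bsub>D (fst z)\<^esub> p (fst z) [^]\<^bsub>D (fst z)\<^esub> k"
          using c z pc by (simp add: nat_pow_mult)
        assume "local_dvd (D (fst z)) (snd z) (a (fst z)) (p (fst z) [^]\<^bsub>D (fst z)\<^esub> j)"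
          "local_dvd (D (fst z)) (snd z) (b (fst z)) (p (fst z) [^]\<^bsub>D (fst z)\<^esub> k)"
        then show "local_dvd (D (fst z)) (snd z) ((a \<otimes>\<^bsub>R\<^esub> b) (fst z)) (p (fst z) [^]\<^bsub>D (fst z)\<^esub> (j + k))"
          unfolding e R_simps(1)[OF maximal(1)[OF z]]
          using z a b c by (intro primeideal.local_dvd_mult[OF prime]) auto
      qed
      with almost_D(1)[OF ab, of "Suc (j + k)"]
      have "{z\<in>maxs. local_dvd (D (fst z)) (snd z) (p (fst z) [^]\<^bsub>D (fst z)\<^esub> Suc (j + k))
          (p (fst z) [^]\<^bsub>D (fst z)\<^esub> (j + k))} \<in> \<U>"
      proof (rule almost_mono2)
        fix z assume z: "z \<in> maxs"
        assume "local_dvd (D (fst z)) (snd z) (p (fst z) [^]\<^bsub>D (fst z)\<^esub> Suc (j + k)) ((a \<otimes>\<^bsub>R\<^esub> b) (fst z))"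
          "local_dvd (D (fst z)) (snd z) ((a \<otimes>\<^bsub>R\<^esub> b) (fst z)) (p (fst z) [^]\<^bsub>D (fst z)\<^esub> (j + k))"
        then show "local_dvd (D (fst z)) (snd z) (p (fst z) [^]\<^bsub>D (fst z)\<^esub> Suc (j + k))
          (p (fst z) [^]\<^bsub>D (fst z)\<^esub> (j + k))"
          by (rule primeideal.local_dvd_trans[OF prime[OF z]])
            (use c z almost_D(2)[OF ab] in blast)+
      qed
      then show False using self_notin_power_divisible[OF p nz] by blast
    qed
  qed
qed

text \<open>Divisibility by the first power of \<open>p\<close> suffices: locally
  \<open>s x = p c\<close> with \<open>s\<close> outside \<open>M\<close>. Since \<open>Z\<close>
  has at most one maximal ideal over each index, the local denominators assemble to one element
  \<open>s'\<close> of the product outside \<open>ultra_ideal_of\<close>, hence outside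
  \<open>P\<close>. As \<open>s' x\<close> is a multiple of \<open>p\<close>, primality puts
  \<open>x\<close> into \<open>P\<close>.\<close>

lemma power_divisible_subset:
  assumes P: "primeideal P R" and PU: "P \<subseteq> ultra_ideal_of \<Lambda> D \<U>"
    and Z: "Z \<in> \<U>" "inj_on fst Z" and p: "p \<in> P"
  shows "power_divisible \<Lambda> D \<U> p \<subseteq> P"
proof
  interpret P: primeideal P R by fact
  fix x assume x: "x \<in> power_divisible \<Lambda> D \<U> p"
  have pc: "p \<in> carrier R" using p by (rule P.a_Hcarr)
  note xc = almost_D(2)[OF x]
  let ?A = "{z\<in>maxs. local_dvd (D (fst z)) (snd z) (p (fst z) [^]\<^bsub>D (fst z)\<^esub> (1::nat)) (x (fst z))} \<inter> Z"
  have A: "?A \<in> \<U>" using ultrafilter_Int[OF U almost_D(1)[OF x] Z(1)] .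
  define good where "good l s c \<longleftrightarrow> s \<in> carrier (D l) \<and> c \<in> carrier (D l) \<and>
      s \<otimes>\<^bsub>D l\<^esub> x l = p l \<otimes>\<^bsub>D l\<^esub> c \<and> (\<forall>M. (l, M) \<in> ?A \<longrightarrow> s \<notin> M)" for l s c
  have "\<exists>s c. good l s c" if l: "l \<in> \<Lambda>" for l
  proof -
    interpret domain "D l" by (rule domain_component[OF l])
    note xl = component[OF xc l] component[OF pc l]
    show ?thesis
    proof (cases "\<exists>M. (l, M) \<in> ?A")
      case True
      then obtain M where M: "(l, M) \<in> ?A" by blast
      then have "local_dvd (D l) M (p l) (x l)" using xl by simp
      then obtain s d where sd: "s \<in> carrier (D l) - M" "d \<in> carrier (D l)"
        "s \<otimes>\<^bsub>D l\<^esub> x l = p l \<otimes>\<^bsub>D l\<^esub> d" unfolding local_dvd_def by blast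
      moreover have "M' = M" if "(l, M') \<in> ?A" for M'
        using inj_onD[OF Z(2), of "(l, M')" "(l, M)"] that M by auto
      ultimately show ?thesis unfolding good_def by blast
    next
      case False
      \<comment> \<open>No maximal ideal over \<open>l\<close> has to be avoided, so zero serves as
        both \<open>s\<close> and \<open>c\<close>.\<close>
      moreover have "\<zero>\<^bsub>D l\<^esub> \<otimes>\<^bsub>D l\<^esub> x l = p l \<otimes>\<^bsub>D l\<^esub> \<zero>\<^bsub>D l\<^esub>" using xl by simp
      ultimately show ?thesis unfolding good_def using zero_closed by blast
    qed
  qed
  then obtain s d where "\<And>l. l \<in> \<Lambda> \<Longrightarrow> good l (s l) (d l)" by metis
  note sd = this[unfolded good_def]
  \<comment> \<open>Elements of the product are extensional functions, hence the
    restriction.\<close>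
  define s' where "s' = restrict s \<Lambda>"
  define d' where "d' = restrict d \<Lambda>"
  have sc: "s' \<in> carrier R" and dc: "d' \<in> carrier R"
    using sd by (auto simp: product_ring_def s'_def d'_def)
  have "s' \<otimes>\<^bsub>R\<^esub> x = p \<otimes>\<^bsub>R\<^esub> d'"
    using sd by (auto simp: product_ring_def s'_def d'_def restrict_def fun_eq_iff)
  then have sx: "s' \<otimes>\<^bsub>R\<^esub> x \<in> P" using P.I_r_closed[OF p dc] by simp
  have "s' \<notin> P"
  proof
    assume "s' \<in> P"
    then have "{z\<in>maxs. s' (fst z) \<in> snd z} \<in> \<U>" using PU by (auto simp: ultra_ideal_alt)
    then have "{z\<in>maxs. s' (fst z) \<in> snd z} \<inter> ?A \<in> \<U>" using A by (rule ultrafilter_Int[OF U])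
    then obtain z where z: "z \<in> {z\<in>maxs. s' (fst z) \<in> snd z}" "z \<in> ?A"
      using ultrafilter_nonempty[OF U] by blast
    then have "fst z \<in> \<Lambda>" using maximal by blast
    moreover have "(fst z, snd z) \<in> ?A" using z(2) by (simp only: prod.collapse)
    ultimately have "s (fst z) \<notin> snd z" using sd by blast
    then show False using z(1) \<open>fst z \<in> \<Lambda>\<close> by (simp add: s'_def)
  qed
  then show "x \<in> P" using P.I_prime[OF sc xc sx] by blast
qed

text \<open>The separating element \<open>q\<close> has entries \<open>p l\<close> raised to an
  exponent that is at least any fixed \<open>k\<close> for almost all \<open>l\<close>, so every
  power of \<open>p\<close> divides it almost everywhere. It vanishes only where \<open>p\<close>
  does, because the components are domains.\<close>

lemma zero_psubset_power_divisible:
  assumes ci: "countably_incomplete_ultrafilter \<Lambda> F" and F: "F = induced_ultrafilter \<Lambda> D \<U>"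
    and p: "p \<in> carrier R" "p \<notin> zero_ideal_of \<Lambda> D F"
  shows "zero_ideal_of \<Lambda> D F \<subset> power_divisible \<Lambda> D \<U> p"
proof -
  have uf: "ultrafilter_on \<Lambda> F" using ci by (simp add: countably_incomplete_ultrafilter_def)
  note iff = mem_induced_ultrafilter_iff[OF U uf[unfolded F], folded F]
  obtain n :: "'i \<Rightarrow> nat" where n: "\<And>k. {l\<in>\<Lambda>. k \<le> n l} \<in> F"
    using ultrafilter_index[OF ci] by blast
  define q where "q = (\<lambda>l\<in>\<Lambda>. p l [^]\<^bsub>D l\<^esub> n l)"
  have qc: "q \<in> carrier R"
    using pow_component[OF p(1)] by (auto simp: q_def product_ring_def)
  have "q \<in> power_divisible \<Lambda> D \<U> p"
    unfolding power_divisible_def mem_Collect_eq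
  proof (intro conjI allI)
    fix k :: nat
    have "{z\<in>maxs. fst z \<in> {l\<in>\<Lambda>. k \<le> n l}} \<in> \<U>" using n[of k] by (subst iff[symmetric]) auto
    then show "{z\<in>maxs. local_dvd (D (fst z)) (snd z) (p (fst z) [^]\<^bsub>D (fst z)\<^esub> k) (q (fst z))} \<in> \<U>"
      by (rule almost_mono)
        (use component[OF p(1)] in \<open>auto simp: q_def intro!: primeideal.local_dvd_pow_le[OF prime]\<close>)
  qed (rule qc)
  moreover have "q \<notin> zero_ideal_of \<Lambda> D F"
  proof
    assume "q \<in> zero_ideal_of \<Lambda> D F"
    then have "{l\<in>\<Lambda>. q l = \<zero>\<^bsub>D l\<^esub>} \<in> F" by (simp add: zero_ideal_of_def)
    moreover have "{l\<in>\<Lambda>. q l = \<zero>\<^bsub>D l\<^esub>} \<subseteq> {l\<in>\<Lambda>. p l = \<zero>\<^bsub>D l\<^esub>}"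
      using domain.nat_pow_nonzero[OF domain_component component[OF p(1)]] by (auto simp: q_def)
    ultimately have "{l\<in>\<Lambda>. p l = \<zero>\<^bsub>D l\<^esub>} \<in> F" by (rule ultrafilter_mono[OF uf]) auto
    then show False using p by (simp add: zero_ideal_of_def)
  qed
  moreover have "x \<in> power_divisible \<Lambda> D \<U> p" if x: "x \<in> zero_ideal_of \<Lambda> D F" for x
    unfolding power_divisible_def mem_Collect_eq
  proof (intro conjI allI)
    fix k :: nat
    have "{z\<in>maxs. fst z \<in> {l\<in>\<Lambda>. x l = \<zero>\<^bsub>D l\<^esub>}} \<in> \<U>"
      using x by (subst iff[symmetric]) (auto simp: zero_ideal_of_def)
    then show "{z\<in>maxs. local_dvd (D (fst z)) (snd z) (p (fst z) [^]\<^bsub>D (fst z)\<^esub> k) (x (fst z))} \<in> \<U>"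
      by (rule almost_mono)
        (simp add: primeideal.local_dvd_zero[OF prime] pow_component[OF p(1)])
  qed (use x in \<open>simp add: zero_ideal_of_def\<close>)
  ultimately show ?thesis by blast
qed

text \<open>Any \<open>p\<close> in \<open>P\<close> outside \<open>zero_ideal_of\<close> yields the
  prime \<open>power_divisible \<Lambda> D \<U> p\<close>; it differs from \<open>P\<close> because
  it omits \<open>p\<close>.\<close>

lemma smaller_prime:
  assumes ci: "countably_incomplete_ultrafilter \<Lambda> F" and F: "F = induced_ultrafilter \<Lambda> D \<U>"
    and Z: "Z \<in> \<U>" "inj_on fst Z"
    and P: "primeideal P R" "zero_ideal_of \<Lambda> D F \<subset> P" "P \<subseteq> ultra_ideal_of \<Lambda> D \<U>"
  shows "\<exists>Q. primeideal Q R \<and> zero_ideal_of \<Lambda> D F \<subset> Q \<and> Q \<subset> P"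
proof -
  have uf: "ultrafilter_on \<Lambda> F" using ci by (simp add: countably_incomplete_ultrafilter_def)
  obtain p where p: "p \<in> P" "p \<notin> zero_ideal_of \<Lambda> D F" using P(2) by blast
  have pU: "p \<in> ultra_ideal_of \<Lambda> D \<U>" using p P(3) by blast
  then have pc: "p \<in> carrier R" by (simp add: ultra_ideal_alt)
  \<comment> \<open>That \<open>p\<close> is nonzero modulo \<open>F\<close> is carried over to
    \<open>\<U>\<close>, where primality is tested.\<close>
  have "{z\<in>maxs. fst z \<in> {l\<in>\<Lambda>. p l = \<zero>\<^bsub>D l\<^esub>}} \<notin> \<U>"
    using p(2) pc mem_induced_ultrafilter_iff[OF U uf[unfolded F], of "{l\<in>\<Lambda>. p l = \<zero>\<^bsub>D l\<^esub>}"]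
    by (auto simp: zero_ideal_of_def F)
  then have "{z\<in>maxs. p (fst z) = \<zero>\<^bsub>D (fst z)\<^esub>} \<notin> \<U>"
    using maximal(1) by (simp cong: conj_cong)
  note Q = primeideal_power_divisible[OF pU this]
  show ?thesis
    using Q zero_psubset_power_divisible[OF ci F pc p(2)]
      power_divisible_subset[OF P(1,3) Z p(1)] p(1)
    by blast
qed

end

section \<open>Infinite height by descent, and the conclusion\<close>

lemma ideal_height_infinite:
  assumes step: "\<And>P. primeideal P R \<Longrightarrow> \<Phi> P \<Longrightarrow> \<exists>Q. primeideal Q R \<and> \<Phi> Q \<and> Q \<subset> P"
    and P: "primeideal P R" "\<Phi> P"
  shows "ideal_height R P = \<infinity>"
proof -
  \<comment> \<open>The height is a supremum over finite chains, so no infinite descending chain is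
    built: a chain of length \<open>n\<close> ending in a smaller prime \<open>Q\<close> is extended
    by \<open>P\<close> on top.\<close>
  have chain: "\<exists>C :: nat \<Rightarrow> 'a set. (\<forall>i\<le>n. primeideal (C i) R) \<and> (\<forall>i<n. C i \<subset> C (Suc i)) \<and> C n = P"
    for n
    using P
  proof (induction n arbitrary: P)
    case 0
    then show ?case by (intro exI[of _ "\<lambda>_. P"]) simp
  next
    case (Suc n)
    obtain Q where Q: "primeideal Q R" "\<Phi> Q" "Q \<subset> P" using step Suc.prems by blast
    obtain C where C: "\<forall>i\<le>n. primeideal (C i) R" "\<forall>i<n. C i \<subset> C (Suc i)" "C n = Q"
      using Suc.IH[OF Q(1,2)] by blast
    let ?C = "C(Suc n := P)"
    have "\<forall>i\<le>Suc n. primeideal (?C i) R" using C Suc.prems by (simp add: le_Suc_eq)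
    moreover have "\<forall>i<Suc n. ?C i \<subset> ?C (Suc i)" using C Q(3) by (auto simp: less_Suc_eq)
    ultimately show ?case by (intro exI[of _ ?C]) simp
  qed
  have le: "enat n \<le> ideal_height R P" for n
    unfolding ideal_height_def by (intro Sup_upper CollectI exI[of _ n] conjI[OF refl] chain)
  show ?thesis
  proof (cases "ideal_height R P")
    \<comment> \<open>A finite height \<open>m\<close> contradicts a chain of length
      \<open>m + 1\<close>.\<close>
    case (enat m)
    then show ?thesis using le[of "Suc m"] by simp
  qed
qed

theorem theorem3p13:
  fixes \<Lambda> :: "'i set" and D :: "'i \<Rightarrow> ('a, 'm) ring_scheme"
    and F :: "'i set set" and \<U> :: "('i \<times> 'a set) set set"
  defines "R \<equiv> product_ring \<Lambda> D"
  assumes prufer: "\<And>l. l \<in> \<Lambda> \<Longrightarrow> prufer_domain (D l)"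
    and F: "countably_incomplete_ultrafilter \<Lambda> F"
    and U: "ultrafilter_on (max_union \<Lambda> D) \<U>"
    and induced: "F = induced_ultrafilter \<Lambda> D \<U>"
    and bounded: "\<exists>Y\<in>\<U>. \<exists>N::nat. \<forall>l\<in>\<Lambda>.
       finite (Y \<inter> ({l} \<times> max_ideals (D l))) \<and> card (Y \<inter> ({l} \<times> max_ideals (D l))) \<le> N"
  shows "(\<forall>P. primeideal P R \<and> zero_ideal_of \<Lambda> D F \<subset> P \<and> P \<subseteq> ultra_ideal_of \<Lambda> D \<U> \<longrightarrow>
            (\<exists>Q. primeideal Q R \<and> zero_ideal_of \<Lambda> D F \<subset> Q \<and> Q \<subset> P)) \<and>
         (\<forall>P. primeideal P R \<and> zero_ideal_of \<Lambda> D F \<subset> P \<and> P \<subseteq> ultra_ideal_of \<Lambda> D \<U> \<longrightarrow>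
            ideal_height R P = \<infinity>)"
proof -
  interpret prufer_ultraproduct \<Lambda> D \<U>
    using prufer U by unfold_locales
  obtain Y N where Y: "Y \<in> \<U>" and N: "\<And>l. l \<in> \<Lambda> \<Longrightarrow> finite (Y \<inter> ({l} \<times> max_ideals (D l)))
      \<and> card (Y \<inter> ({l} \<times> max_ideals (D l))) \<le> N"
    using bounded by blast
  have YX: "Y \<subseteq> max_union \<Lambda> D" using U Y by (rule ultrafilter_subset)
  \<comment> \<open>\<open>ultrafilter_section\<close> asks for the bound at every \<open>l\<close>
    of the type; outside \<open>\<Lambda>\<close> the fibre is empty.\<close>
  have "finite {z\<in>Y. fst z = l} \<and> card {z\<in>Y. fst z = l} \<le> N" for l
  proof (cases "l \<in> \<Lambda>")
    case True
    have "{z\<in>Y. fst z = l} = Y \<inter> ({l} \<times> max_ideals (D l))"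
      using YX by (auto simp: max_union_def)
    then show ?thesis using N[OF True] by simp
  next
    case False
    then have "{z\<in>Y. fst z = l} = {}" using YX by (auto simp: max_union_def)
    then show ?thesis by (metis card.empty finite.emptyI le0)
  qed
  from ultrafilter_section[OF U Y this] obtain Z where Z: "Z \<in> \<U>" "inj_on fst Z" by blast
  note small = smaller_prime[OF F induced Z, folded R_def]
  \<comment> \<open>The upper bound belongs to the invariant so that the descent can be repeated; it
    passes from \<open>P\<close> to every smaller \<open>Q\<close>.\<close>
  let ?\<Phi> = "\<lambda>P. zero_ideal_of \<Lambda> D F \<subset> P \<and> P \<subseteq> ultra_ideal_of \<Lambda> D \<U>"
  have "\<exists>Q. primeideal Q R \<and> ?\<Phi> Q \<and> Q \<subset> P" if "primeideal P R" "?\<Phi> P" for P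
    using small[of P] that by (meson order_trans psubset_imp_subset)
  then have "ideal_height R P = \<infinity>" if "primeideal P R" "?\<Phi> P" for P
    using that by (rule ideal_height_infinite[where \<Phi> = ?\<Phi>])
  then show ?thesis using small by blast
qed

end
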